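(* Let $S\neq\mathbb{N}$ be a numerical semigroup with maximal ideal $M=S\setminus\{0\}$. If Wilf's inequality $F(S)+1\leq n(S)\cdot\nu(S)$ holds for $S$, then for all $a\in\mathbb{N}$ with $a\in M-2M$ it holds for the dilatation $S+a$, i.e. $F(S+a)+1\leq n(S+a)\cdot\nu(S+a)$.
   Context: $\mathbb{N}$ denotes the nonnegative integers. A numerical semigroup $S$ is a submonoid of $(\mathbb{N},+)$ with $\mathbb{N}\setminus S$ finite. With $M=S\setminus\{0\}$, the condition $a\in M-2M$ means $a+s_1+s_2\in M$ for all $s_1,s_2\in M$. For such $a\in\mathbb{N}$, the dilatation of $S$ with respect to $a$ is the numerical semigroup $S+a=\{0\}\cup\{s+a : s\in M\}$ (so here $S+a$ is not the full translate of $S$). $F(S)=\max(\mathbb{N}\setminus S)$ is the Frobenius number, $n(S)=|S\cap[0,F(S)]|$, and $\nu(S)$ is the embedding dimension, i.e. the cardinality of the unique minimal set of generators of $S$ as a monoid. Wilf's conjecture is said to hold for $S$ if $F(S)+1\le n(S)\cdot\nu(S)$. *)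

theory Defs
  imports Main "HOL.Hull"
begin

definition submonoid_nat :: "nat set \<Rightarrow> bool" where
  "submonoid_nat S \<longleftrightarrow> 0 \<in> S \<and> (\<forall>x\<in>S. \<forall>y\<in>S. x + y \<in> S)"

definition numerical_semigroup :: "nat set \<Rightarrow> bool" where
  "numerical_semigroup S \<longleftrightarrow> submonoid_nat S \<and> finite (UNIV - S)"

definition max_ideal :: "nat set \<Rightarrow> nat set" where
  "max_ideal S = S - {0}"

text \<open>The nonnegative part of \<open>M - 2M\<close>, where \<open>M\<close> is the maximal ideal of \<open>S\<close>.\<close>

definition M_minus_2M :: "nat set \<Rightarrow> nat set" where
  "M_minus_2M S = {a. \<forall>s1\<in>max_ideal S. \<forall>s2\<in>max_ideal S. a + s1 + s2 \<in> max_ideal S}"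

definition dilatation :: "nat set \<Rightarrow> nat \<Rightarrow> nat set" where
  "dilatation S a = {0} \<union> {s + a | s. s \<in> max_ideal S}"

text \<open>Only meaningful for \<open>S \<noteq> UNIV\<close>: \<^const>\<open>Max\<close> is unspecified on the empty set.\<close>

definition Frobenius_number :: "nat set \<Rightarrow> nat" where
  "Frobenius_number S = Max (UNIV - S)"

definition n_left :: "nat set \<Rightarrow> nat" where
  "n_left S = card (S \<inter> {0..Frobenius_number S})"

definition minimal_generating_set :: "nat set \<Rightarrow> nat set \<Rightarrow> bool" where
  "minimal_generating_set S A \<longleftrightarrow>
     submonoid_nat hull A = S \<and> (\<forall>B. B \<subset> A \<longrightarrow> submonoid_nat hull B \<noteq> S)"

text \<open>The description is proper and the cardinality is that of a finite set; see
  \<open>ex1_minimal_generating_set\<close> and \<open>finite_minimal_generating_set\<close> below.\<close>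

definition embedding_dimension :: "nat set \<Rightarrow> nat" where
  "embedding_dimension S = card (THE A. minimal_generating_set S A)"

definition wilf :: "nat set \<Rightarrow> bool" where
  "wilf S \<longleftrightarrow> Frobenius_number S + 1 \<le> n_left S * embedding_dimension S"


definition atoms :: "nat set \<Rightarrow> nat set" where
  "atoms S = {x \<in> max_ideal S. \<forall>y\<in>max_ideal S. \<forall>z\<in>max_ideal S. x \<noteq> y + z}"

lemma submonoid_nat_hull: "submonoid_nat (submonoid_nat hull A)"
proof (rule hull_in)
  fix T assume "Ball T submonoid_nat"
  then have "submonoid_nat X" if "X \<in> T" for X
    using that by (rule bspec)
  then show "submonoid_nat (\<Inter> T)"
    unfolding submonoid_nat_def by simp
qed

lemma zero_in_hull: "0 \<in> submonoid_nat hull A"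
  using submonoid_nat_hull[of A] unfolding submonoid_nat_def[of "_ hull _"] by (rule conjunct1)

lemma add_in_hull:
  "x \<in> submonoid_nat hull A \<Longrightarrow> y \<in> submonoid_nat hull A \<Longrightarrow> x + y \<in> submonoid_nat hull A"
  using submonoid_nat_hull[of A] unfolding submonoid_nat_def[of "_ hull _"] by blast

lemma atoms_subset_generators:
  assumes S: "submonoid_nat S" and A: "submonoid_nat hull A = S"
  shows "atoms S \<subseteq> A"
proof
  fix x assume x: "x \<in> atoms S"
  show "x \<in> A"
  proof (rule ccontr)
    assume "x \<notin> A"
    moreover have "A \<subseteq> S" using hull_subset[of A submonoid_nat] unfolding A .
    ultimately have "A \<subseteq> S - {x}" by blast
    moreover have "submonoid_nat (S - {x})"
      unfolding submonoid_nat_def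
    proof (intro conjI ballI)
      show "0 \<in> S - {x}" using S x by (auto simp: submonoid_nat_def atoms_def max_ideal_def)
    next
      fix y z assume yz: "y \<in> S - {x}" "z \<in> S - {x}"
      have "y + z \<in> S" using S yz unfolding submonoid_nat_def by blast
      moreover have "y + z \<noteq> x"
      proof
        assume eq: "y + z = x"
        then have "y \<noteq> 0" "z \<noteq> 0" using yz by (metis DiffD2 add_0 insertI1, metis DiffD2 add_0_right insertI1)
        then have "y \<in> max_ideal S" "z \<in> max_ideal S" using yz unfolding max_ideal_def by blast+
        then show False using x eq unfolding atoms_def by blast
      qed
      ultimately show "y + z \<in> S - {x}" by blast
    qed
    ultimately have "submonoid_nat hull A \<subseteq> S - {x}" by (rule hull_minimal)
    then show False using x unfolding A atoms_def max_ideal_def by blast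
  qed
qed

lemma hull_atoms:
  assumes S: "submonoid_nat S"
  shows "submonoid_nat hull (atoms S) = S"
proof
  show "submonoid_nat hull (atoms S) \<subseteq> S"
    using S by (intro hull_minimal) (auto simp: atoms_def max_ideal_def)
next
  have "x \<in> S \<Longrightarrow> x \<in> submonoid_nat hull (atoms S)" for x
  proof (induction x rule: less_induct)
    case (less x)
    consider "x = 0" | "x \<in> atoms S"
      | y z where "y \<in> max_ideal S" "z \<in> max_ideal S" "x = y + z"
      using less.prems unfolding atoms_def max_ideal_def by blast
    then show ?case
    proof cases
      case 1
      then show ?thesis by (simp add: zero_in_hull)
    next
      case 2
      then show ?thesis by (rule hull_inc)
    next
      case 3
      then have "y \<in> submonoid_nat hull (atoms S)" "z \<in> submonoid_nat hull (atoms S)"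
        using less.IH by (auto simp: max_ideal_def)
      then show ?thesis using 3 by (simp add: add_in_hull)
    qed
  qed
  then show "S \<subseteq> submonoid_nat hull (atoms S)" by blast
qed

lemma minimal_generating_set_iff:
  assumes "submonoid_nat S"
  shows "minimal_generating_set S A \<longleftrightarrow> A = atoms S"
proof
  assume A: "minimal_generating_set S A"
  then have "atoms S \<subseteq> A"
    using atoms_subset_generators[OF assms] by (simp add: minimal_generating_set_def)
  moreover have "\<not> atoms S \<subset> A"
    using A hull_atoms[OF assms] by (auto simp: minimal_generating_set_def)
  ultimately show "A = atoms S" by blast
next
  assume "A = atoms S"
  then show "minimal_generating_set S A"
    using atoms_subset_generators[OF assms] hull_atoms[OF assms]
    unfolding minimal_generating_set_def by (simp add: psubset_eq) (metis subset_antisym)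
qed

lemma ex1_minimal_generating_set:
  assumes "numerical_semigroup S"
  shows "\<exists>!A. minimal_generating_set S A"
  using assms minimal_generating_set_iff by (auto simp: numerical_semigroup_def)

lemma finite_minimal_generating_set:
  assumes S: "numerical_semigroup S" and A: "minimal_generating_set S A"
  shows "finite A"
proof -
  have sub: "submonoid_nat S" and fin: "finite (UNIV - S)"
    using S by (auto simp: numerical_semigroup_def)
  have A: "A = atoms S" using A minimal_generating_set_iff[OF sub] by simp
  have "infinite S" using fin by (metis finite_Diff2 infinite_UNIV_nat)
  then obtain m where m: "m \<in> S" "m > 0"
    by (metis finite_nat_set_iff_bounded_le gr_zeroI le_zero_eq)
  have "atoms S \<subseteq> {..m} \<union> (\<lambda>g. g + m) ` (UNIV - S)"
  proof
    fix x assume x: "x \<in> atoms S"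
    show "x \<in> {..m} \<union> (\<lambda>g. g + m) ` (UNIV - S)"
    proof (cases "x \<le> m")
      case False
      then have eq: "x = (x - m) + m" by simp
      have "x - m \<notin> S"
      proof
        assume "x - m \<in> S"
        then have "x - m \<in> max_ideal S" "m \<in> max_ideal S"
          using m False by (auto simp: max_ideal_def)
        then show False using x eq unfolding atoms_def by blast
      qed
      then have "x \<in> (\<lambda>g. g + m) ` (UNIV - S)" using eq by (intro image_eqI[where x = "x - m"]) simp_all
      then show ?thesis by simp
    qed simp
  qed
  then show ?thesis using A fin by (meson finite_UnI finite_atMost finite_imageI finite_subset)
qed

lemma numerical_semigroup_dilatation:
  assumes S: "numerical_semigroup S" and a: "a \<in> M_minus_2M S"
  shows "numerical_semigroup (dilatation S a)"
proof -
  have "UNIV - dilatation S a \<subseteq> {..a} \<union> (\<lambda>g. g + a) ` (UNIV - S)"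
  proof
    fix x assume x: "x \<in> UNIV - dilatation S a"
    show "x \<in> {..a} \<union> (\<lambda>g. g + a) ` (UNIV - S)"
    proof (cases "x \<le> a")
      case False
      then have eq: "x = (x - a) + a" by simp
      have "x - a \<notin> S"
      proof
        assume "x - a \<in> S"
        then have "x - a \<in> max_ideal S" using False by (auto simp: max_ideal_def)
        then show False using x eq unfolding dilatation_def by blast
      qed
      then have "x \<in> (\<lambda>g. g + a) ` (UNIV - S)" using eq by (intro image_eqI[where x = "x - a"]) simp_all
      then show ?thesis by simp
    qed simp
  qed
  then have fin: "finite (UNIV - dilatation S a)"
    using S unfolding numerical_semigroup_def
    by (meson finite_UnI finite_atMost finite_imageI finite_subset)
  have sum: "(s + a) + (t + a) \<in> dilatation S a"
    if "s \<in> max_ideal S" "t \<in> max_ideal S" for s t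
  proof -
    have "a + s + t \<in> max_ideal S" using a that by (simp add: M_minus_2M_def)
    moreover have "(s + a) + (t + a) = (a + s + t) + a" by simp
    ultimately show ?thesis unfolding dilatation_def by blast
  qed
  have "x + y \<in> dilatation S a" if x: "x \<in> dilatation S a" and y: "y \<in> dilatation S a" for x y
  proof (cases "x = 0 \<or> y = 0")
    case True
    then show ?thesis using x y by auto
  next
    case False
    then obtain s t where "s \<in> max_ideal S" "x = s + a" "t \<in> max_ideal S" "y = t + a"
      using x y unfolding dilatation_def by blast
    then show ?thesis using sum by blast
  qed
  moreover have "0 \<in> dilatation S a" by (simp add: dilatation_def)
  ultimately show ?thesis
    using fin unfolding numerical_semigroup_def submonoid_nat_def by simp
qed

end

theory Submission
  imports Defs
begin

text \<open>Dilatation by \<open>a\<close> moves the Frobenius number up by \<open>a\<close> and leaves \<open>n\<close> unchanged. The atoms of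
  \<open>S + a\<close> are the translates by \<open>a\<close> of \<open>M - (2M + a)\<close>; as \<open>2M + a\<close> has exactly \<open>a\<close> more gaps
  than \<open>2M\<close>, and both lie in \<open>M\<close>, the embedding dimension grows by \<open>a\<close> as well. Since \<open>n(S) \<ge> 1\<close>, the
  right-hand side of Wilf's inequality grows by at least \<open>a\<close>.\<close>

definition double_ideal :: "nat set \<Rightarrow> nat set" where
  "double_ideal S = {y + z | y z. y \<in> max_ideal S \<and> z \<in> max_ideal S}"

lemma atoms_eq: "atoms S = max_ideal S - double_ideal S"
  unfolding atoms_def double_ideal_def by blast

lemma embedding_dimension_eq_card_atoms:
  assumes "submonoid_nat S"
  shows "embedding_dimension S = card (atoms S)"
  by (simp add: embedding_dimension_def minimal_generating_set_iff[OF assms])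

lemma finite_atoms:
  assumes "numerical_semigroup S"
  shows "finite (atoms S)"
proof (rule finite_minimal_generating_set[OF assms])
  show "minimal_generating_set S (atoms S)"
    using assms minimal_generating_set_iff[of S] by (simp add: numerical_semigroup_def)
qed

text \<open>The maximal ideal of \<open>S + a\<close> is \<open>M + a\<close>, so sums of two of its
  elements form \<open>2M + 2a\<close>. One shift by \<open>a\<close> is common to both sets and
  factors out of their difference because translation is injective.\<close>

lemma atoms_dilatation:
  "atoms (dilatation S a) = (\<lambda>s. s + a) ` (max_ideal S - (\<lambda>t. t + a) ` double_ideal S)"
proof -
  have M: "max_ideal (dilatation S a) = (\<lambda>s. s + a) ` max_ideal S"
    by (auto simp: max_ideal_def dilatation_def)
  have "double_ideal (dilatation S a) =
      {(y + a) + (z + a) | y z. y \<in> max_ideal S \<and> z \<in> max_ideal S}"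
    unfolding double_ideal_def M by blast
  also have "\<dots> = {(y + z) + a + a | y z. y \<in> max_ideal S \<and> z \<in> max_ideal S}"
    by (simp only: ac_simps)
  also have "\<dots> = (\<lambda>s. s + a) ` (\<lambda>t. t + a) ` double_ideal S"
    unfolding double_ideal_def by blast
  finally have "double_ideal (dilatation S a) = (\<lambda>s. s + a) ` (\<lambda>t. t + a) ` double_ideal S" .
  moreover have "inj (\<lambda>s. s + a)" by (simp add: inj_def)
  ultimately show ?thesis
    unfolding atoms_eq M by (simp add: image_set_diff)
qed

text \<open>The gaps of the translate are the \<open>a\<close> numbers below \<open>a\<close>
  together with the shifted gaps of \<open>T\<close>.\<close>

lemma card_compl_translate:
  fixes T :: "nat set"
  assumes "finite (- T)"
  shows "finite (- (\<lambda>t. t + a) ` T)" and "card (- (\<lambda>t. t + a) ` T) = card (- T) + a"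
proof -
  have eq: "- (\<lambda>t. t + a) ` T = {..<a} \<union> (\<lambda>t. t + a) ` (- T)"
  proof (intro set_eqI)
    fix x
    show "x \<in> - (\<lambda>t. t + a) ` T \<longleftrightarrow> x \<in> {..<a} \<union> (\<lambda>t. t + a) ` (- T)"
    proof (cases "x < a")
      case True
      then show ?thesis by auto
    next
      case False
      then obtain y where "x = y + a" by (metis add.commute le_iff_add not_less)
      then show ?thesis by auto
    qed
  qed
  show "finite (- (\<lambda>t. t + a) ` T)" unfolding eq using assms by simp
  have "card ({..<a} \<union> (\<lambda>t. t + a) ` (- T)) = card {..<a} + card ((\<lambda>t. t + a) ` (- T))"
    using assms by (intro card_Un_disjoint) auto
  then show "card (- (\<lambda>t. t + a) ` T) = card (- T) + a"
    unfolding eq by (simp add: card_image)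
qed

lemma embedding_dimension_dilatation:
  assumes S: "numerical_semigroup S" and a: "a \<in> M_minus_2M S"
  shows "embedding_dimension (dilatation S a) = embedding_dimension S + a"
proof -
  let ?M = "max_ideal S" and ?D = "double_ideal S" and ?Da = "(\<lambda>t. t + a) ` double_ideal S"
  have sub: "submonoid_nat S" using S by (simp add: numerical_semigroup_def)
  have sub_a: "submonoid_nat (dilatation S a)"
    using numerical_semigroup_dilatation[OF S a] by (simp add: numerical_semigroup_def)
  have D: "?D \<subseteq> ?M"
    using sub by (auto simp: double_ideal_def max_ideal_def submonoid_nat_def)
  \<comment> \<open>For elements \<open>y\<close>, \<open>z\<close> of \<open>M\<close>, membership
    of \<open>a + y + z\<close> in \<open>M\<close> is the defining condition of
    \<open>M - 2M\<close>.\<close>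
  have Da: "?Da \<subseteq> ?M"
    using a by (auto simp: double_ideal_def M_minus_2M_def algebra_simps)
  have "- ?M \<subseteq> insert 0 (UNIV - S)" by (auto simp: max_ideal_def)
  then have fin_M: "finite (- ?M)"
    using S by (auto simp: numerical_semigroup_def intro: finite_subset)
  \<comment> \<open>\<open>M\<close> and \<open>X\<close> are infinite, so the size of
    \<open>M - X\<close> is read off from their finite complements; \<open>X\<close> will be
    \<open>2M\<close> and \<open>2M + a\<close>.\<close>
  have gaps: "card (- X) = card (- ?M) + card (?M - X)"
    if "finite (- X)" "X \<subseteq> ?M" for X
  proof -
    have "- X = - ?M \<union> (?M - X)" using that by blast
    moreover have "finite (?M - X)" using that(1) by (rule finite_subset[rotated]) blast
    ultimately show ?thesis using fin_M card_Un_disjoint[of "- ?M" "?M - X"] by auto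
  qed
  \<comment> \<open>A number outside \<open>2M\<close> either lies outside \<open>M\<close> or is an
    atom, and there are finitely many of each.\<close>
  have "- ?D = - ?M \<union> atoms S" using D by (auto simp: atoms_eq)
  then have fin_D: "finite (- ?D)" using fin_M finite_atoms[OF S] by simp
  \<comment> \<open>The two instances of \<open>gaps\<close> share the term
    \<open>card (- ?M)\<close>, which cancels and leaves the \<open>a\<close> extra gaps of
    \<open>2M + a\<close>.\<close>
  have "card (?M - ?Da) = card (?M - ?D) + a"
    using gaps[OF fin_D D] gaps[OF card_compl_translate(1)[OF fin_D] Da]
      card_compl_translate(2)[OF fin_D, of a] by simp
  then show ?thesis
    by (simp add: embedding_dimension_eq_card_atoms sub sub_a atoms_dilatation card_image
        flip: atoms_eq)
qed

lemma Frobenius_number_dilatation: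
  assumes S: "numerical_semigroup S" "S \<noteq> UNIV" and a: "a \<in> M_minus_2M S"
  shows "Frobenius_number (dilatation S a) = Frobenius_number S + a"
proof -
  let ?F = "Frobenius_number S"
  have fin: "finite (UNIV - S)" and zero: "0 \<in> S"
    using S(1) by (auto simp: numerical_semigroup_def submonoid_nat_def)
  have F: "?F \<notin> S"
    using Max_in[OF fin] S(2) by (auto simp: Frobenius_number_def)
  have gap_le: "x \<le> ?F" if "x \<notin> S" for x
    using fin that by (simp add: Frobenius_number_def)
  show ?thesis
    unfolding Frobenius_number_def[of "dilatation S a"]
  proof (rule Max_eqI)
    show "finite (UNIV - dilatation S a)"
      using numerical_semigroup_dilatation[OF S(1) a] by (simp add: numerical_semigroup_def)
    \<comment> \<open>Positivity keeps \<open>?F + a\<close> away from the element 0 of the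
      dilatation, even when \<open>a = 0\<close>.\<close>
    have "?F \<noteq> 0" using F zero by metis
    then show "?F + a \<in> UNIV - dilatation S a"
      using F by (auto simp: dilatation_def max_ideal_def)
  next
    fix x assume x: "x \<in> UNIV - dilatation S a"
    show "x \<le> ?F + a"
    proof (rule ccontr)
      assume large: "\<not> x \<le> ?F + a"
      \<comment> \<open>Here \<open>x - a\<close> exceeds the largest gap of \<open>S\<close>, so it
        is a nonzero element of \<open>S\<close>.\<close>
      then have "x - a \<in> max_ideal S" using gap_le[of "x - a"]
        by (cases "x - a \<in> S") (auto simp: max_ideal_def)
      moreover have "x = (x - a) + a" using large by simp
      ultimately show False using x unfolding dilatation_def by blast
    qed
  qed
qed

lemma n_left_dilatation:
  assumes S: "numerical_semigroup S" "S \<noteq> UNIV" and a: "a \<in> M_minus_2M S"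
  shows "n_left (dilatation S a) = n_left S"
proof -
  \<comment> \<open>Nonzero elements are shifted while 0 stays fixed, matching the shape of the
    dilatation. The cutoff moves by the same \<open>a\<close>, so elements up to the Frobenius
    number correspond, and a shifted nonzero element never collides with 0.\<close>
  let ?f = "\<lambda>s. if s = 0 then 0 else s + a"
  have "0 \<in> S" using S(1) by (simp add: numerical_semigroup_def submonoid_nat_def)
  then have "dilatation S a \<inter> {0..Frobenius_number S + a} = ?f ` (S \<inter> {0..Frobenius_number S})"
    by (auto simp: dilatation_def max_ideal_def image_iff)
  moreover have "inj_on ?f (S \<inter> {0..Frobenius_number S})" by (auto simp: inj_on_def)
  ultimately show ?thesis
    by (simp only: n_left_def Frobenius_number_dilatation[OF assms] card_image)
qed

lemma n_left_pos:
  assumes "numerical_semigroup S"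
  shows "n_left S > 0"
proof -
  have "0 \<in> S \<inter> {0..Frobenius_number S}"
    using assms by (simp add: numerical_semigroup_def submonoid_nat_def)
  then show ?thesis unfolding n_left_def by (subst card_gt_0_iff) blast
qed

theorem proposition2p7:
  fixes S :: "nat set" and a :: nat
  assumes "numerical_semigroup S"
    and "S \<noteq> UNIV"
    and "wilf S"
    and "a \<in> M_minus_2M S"
  shows "wilf (dilatation S a)"
proof -
  have "a \<le> n_left S * a" using n_left_pos[OF assms(1)] by simp
  then have "Frobenius_number S + a + 1 \<le> n_left S * (embedding_dimension S + a)"
    using assms(3) unfolding wilf_def distrib_left by linarith
  then show ?thesis
    by (simp add: wilf_def Frobenius_number_dilatation n_left_dilatation
        embedding_dimension_dilatation assms)
qed

end
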